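(* Let $M$ be a positive integer, let $\zeta>0$, and let $h_1,\dots,h_M$ be independent $\mathcal{CN}(0,1)$ random variables, so that $|h_1|^2,\dots,|h_M|^2$ are independent exponential random variables with unit mean. Let $\gamma = \zeta \max_{1\le i\le M}|h_i|^2$ be the instantaneous SNR under transmit antenna selection (TAS), and let $g(\gamma)=1+\gamma$. Then for every $s\in\mathbb{R}$ the Mellin transform $\mathcal{M}^{\mathrm{TAS}}_{g(\gamma)}(s) = \mathbb{E}[(1+\gamma)^{s-1}]$ is $$\mathcal{M}^{\mathrm{TAS}}_{g(\gamma)}(s) = M\zeta^{s-1}\sum_{k=0}^{M-1}\binom{M-1}{k}(-1)^{k}\,\frac{e^{(k+1)/\zeta}}{(k+1)^s}\,\Gamma\!\left(s,\frac{k+1}{\zeta}\right).$$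
   Context: $\mathcal{CN}(0,1)$ is the circularly-symmetric complex Gaussian distribution with unit variance. In transmit antenna selection with $M$ transmit antennas and one receive antenna, the transmitter uses the antenna with the largest channel gain $|h_i|^2$; $\zeta$ is the average received SNR. The Mellin transform of a nonnegative random variable $X$ is $\mathcal{M}_X(s)=\mathbb{E}[X^{s-1}]$, considered for real $s$. $\Gamma(a,z) = \int_z^\infty t^{a-1}e^{-t}\,\mathrm{d}t$ (for $a\in\mathbb{R}$, $z>0$) is the upper incomplete gamma function. *)

theory Defs
  imports "HOL-Probability.Probability"
begin

text \<open>
  Density of the circularly-symmetric complex Gaussian law with mean \<open>\<mu>\<close> and variance
  \<open>v\<close>, i.e. \<open>v = E[|X - \<mu>|\<^sup>2]\<close>, so the real and the imaginary part each have
  variance \<open>v / 2\<close>.  It is a density with respect to planar Lebesgue measure.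
\<close>

definition complex_normal_density :: "complex \<Rightarrow> real \<Rightarrow> complex \<Rightarrow> real" where
  "complex_normal_density \<mu> v z = exp (- (cmod (z - \<mu>))\<^sup>2 / v) / (pi * v)"

lemma complex_normal_density_eq_normal_density:
  assumes "v > 0"
  shows "complex_normal_density \<mu> v z =
    normal_density (Re \<mu>) (sqrt (v / 2)) (Re z) * normal_density (Im \<mu>) (sqrt (v / 2)) (Im z)"
proof -
  have "- (cmod (z - \<mu>))\<^sup>2 / v = - (Re z - Re \<mu>)\<^sup>2 / v + - (Im z - Im \<mu>)\<^sup>2 / v"
    using assms by (simp add: cmod_power2 field_simps)
  then have "exp (- (cmod (z - \<mu>))\<^sup>2 / v) =
      exp (- (Re z - Re \<mu>)\<^sup>2 / v) * exp (- (Im z - Im \<mu>)\<^sup>2 / v)"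
    by (simp only: exp_add)
  moreover have "sqrt (pi * v) * sqrt (pi * v) = pi * v"
    using assms by simp
  ultimately show ?thesis
    using assms unfolding complex_normal_density_def normal_density_def by simp
qed

text \<open>
  For a nonnegative random variable \<open>X\<close>.  Since \<open>0 powr a = 0\<close> for every \<open>a\<close>,
  outcomes with \<open>X = 0\<close> contribute nothing, even at \<open>s = 1\<close>.
\<close>

definition mellin_transform :: "'a measure \<Rightarrow> ('a \<Rightarrow> real) \<Rightarrow> real \<Rightarrow> real" where
  "mellin_transform P X s = (\<integral>\<omega>. X \<omega> powr (s - 1) \<partial>P)"

definition upper_incomplete_Gamma :: "real \<Rightarrow> real \<Rightarrow> real" where
  "upper_incomplete_Gamma a z = (LBINT t:{z<..}. t powr (a - 1) * exp (- t))"

definition tas_snr :: "nat \<Rightarrow> real \<Rightarrow> (nat \<Rightarrow> 'a \<Rightarrow> complex) \<Rightarrow> 'a \<Rightarrow> real" where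
  "tas_snr M \<zeta> h \<omega> = \<zeta> * Max ((\<lambda>i. (cmod (h i \<omega>))\<^sup>2) ` {1..M})"

end

theory Submission
  imports Defs
begin

text \<open>
  Pushing planar Lebesgue measure forward along \<open>z \<mapsto> |z|\<^sup>2\<close> gives \<open>\<pi>\<close> times Lebesgue measure on
  the half-line, because the disc of radius \<open>\<surd>t\<close> has area \<open>\<pi> t\<close>; hence the gains \<open>|h\<^sub>i|\<^sup>2\<close>
  are exponential.  By independence their maximum has the density \<open>M (1 - e\<^sup>-\<^sup>x)\<^sup>M\<^sup>-\<^sup>1 e\<^sup>-\<^sup>x\<close>.  Expanding
  it binomially reduces the expectation to integrals of \<open>(1 + \<zeta> x)\<^sup>s\<^sup>-\<^sup>1 e\<^sup>-\<^sup>c\<^sup>x\<close>, and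
  the substitution \<open>t = c / \<zeta> + c x\<close> turns each into an incomplete gamma function.
\<close>

lemma distr_cmod_square_lborel:
  "distr lborel lborel (\<lambda>z. (cmod z)\<^sup>2) = density lborel (\<lambda>x. ennreal (pi * indicator {0..} x))"
    \<comment> \<open>Half-lines are stable under intersection and generate the Borel sets. Both
      measures are infinite, so uniqueness also needs a countable cover by sets of finite measure;
      the half-lines with natural endpoints provide it.\<close>
    (is "?L = ?R")
proof (rule measure_eqI_generator_eq_countable[where \<Omega> = UNIV and E = "range atMost"
        and A = "range (\<lambda>n. {..real n})"])
  have em: "emeasure ?L {..a} = ennreal (pi * max 0 a)" for a
  proof (cases "a \<ge> 0")
    case True
    have "(\<lambda>z. (cmod z)\<^sup>2) -` {..a} = cball 0 (sqrt a)"
      using True by (auto simp: real_le_rsqrt sqrt_ge_absD intro: real_le_rsqrt)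
    then show ?thesis
      using True by (simp add: emeasure_distr emeasure_cball unit_ball_vol_2)
  next
    case False
    then have "\<not> (cmod z)\<^sup>2 \<le> a" for z
      by (meson order_trans zero_le_power2)
    then have "(\<lambda>z. (cmod z)\<^sup>2) -` {..a} = {}"
      by (simp add: vimage_def)
    then show ?thesis
      using False by (simp add: emeasure_distr)
  qed
  show "emeasure ?L X = emeasure ?R X" if "X \<in> range atMost" for X
  proof -
    from that obtain a where X: "X = {..a}" by auto
    have "emeasure ?R {..a} = (\<integral>\<^sup>+x. ennreal pi * indicator {0..a} x \<partial>lborel)"
      by (auto simp: emeasure_density intro!: nn_integral_cong split: split_indicator)
    also have "\<dots> = ennreal (pi * max 0 a)"
      by (auto simp: nn_integral_cmult ennreal_mult max_def)
    finally show ?thesis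
      using X em by simp
  qed
  show "emeasure ?L a \<noteq> \<infinity>" if "a \<in> range (\<lambda>n. {..real n})" for a
    using that em by auto
  show "sets ?L = sigma_sets UNIV (range atMost)" "sets ?R = sigma_sets UNIV (range atMost)"
    by (simp_all add: borel_eq_atMost)
  show "\<Union> (range (\<lambda>n. {..real n})) = UNIV"
    using real_arch_simple by auto
qed (auto simp: Int_stable_def)

text \<open>The Gaussian density depends on \<open>z\<close> only through its squared modulus, so it
  can be carried through the push-forward as a density on the half-line. There its factor
  \<open>1 / pi\<close> cancels the \<open>pi\<close> coming from the area of the disc.\<close>

lemma distributed_cmod_square_complex_normal:
  assumes "distributed P lborel h (\<lambda>z. ennreal (complex_normal_density 0 1 z))"
  shows "distributed P lborel (\<lambda>\<omega>. (cmod (h \<omega>))\<^sup>2) (exponential_density 1)"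
proof -
  let ?g = "\<lambda>u::real. ennreal (exp (- u) / pi)"
  have [measurable]: "h \<in> borel_measurable P"
    using distributed_measurable[OF assms] by simp
  have "distr P lborel (\<lambda>\<omega>. (cmod (h \<omega>))\<^sup>2) = distr (distr P lborel h) lborel (\<lambda>z. (cmod z)\<^sup>2)"
    by (simp add: distr_distr comp_def)
  also have "distr P lborel h = density lborel (\<lambda>z. ?g ((cmod z)\<^sup>2))"
    using distributed_distr_eq_density[OF assms] by (simp add: complex_normal_density_def)
  also have "distr \<dots> lborel (\<lambda>z. (cmod z)\<^sup>2) = density (distr lborel lborel (\<lambda>z. (cmod z)\<^sup>2)) ?g"
    by (rule density_distr[symmetric]) auto
  also have "\<dots> = density lborel (\<lambda>x. ennreal (pi * indicator {0..} x) * ?g x)"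
    by (simp add: distr_cmod_square_lborel density_density_eq)
  also have "\<dots> = density lborel (exponential_density 1)"
    by (intro density_cong)
       (auto simp: exponential_density_def ennreal_mult[symmetric] split: split_indicator)
  finally show ?thesis
    by (simp add: distributed_def)
qed

text \<open>A maximum is at most \<open>a\<close> iff every \<open>X i\<close> is, so independence
  makes its distribution function the product \<open>(1 - exp (- a)) ^ card I\<close> for
  \<open>a \<ge> 0\<close>. The density is the derivative of this power.\<close>

lemma (in prob_space) distributed_Max_exponential:
  assumes "finite I" "I \<noteq> {}"
    and ind: "indep_vars (\<lambda>_. borel) X I"
    and X: "\<And>i. i \<in> I \<Longrightarrow> distributed M lborel (X i) (exponential_density 1)"
  shows "distributed M lborel (\<lambda>\<omega>. Max ((\<lambda>i. X i \<omega>) ` I))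
    (\<lambda>x. real (card I) * (1 - exp (- x)) ^ (card I - 1) * exponential_density 1 x)"
    (is "distributed M lborel ?Y (\<lambda>x. ennreal (?f x))")
proof (rule distributedI_borel_atMost)
  have rv [measurable]: "X i \<in> borel_measurable M" if "i \<in> I" for i
    using distributed_measurable[OF X[OF that]] by simp
  have n: "card I > 0"
    using assms by (simp add: card_gt_0_iff)
  define g where "g a = (if a < 0 then 0 else (1 - exp (- a)) ^ card I)" for a :: real
  show "?Y \<in> borel_measurable M"
    using assms(1) by measurable
  show "?f \<in> borel_measurable borel"
    by measurable
  show "AE x in lborel. 0 \<le> ?f x"
    by (auto simp: exponential_density_def)
  show "emeasure M {\<omega> \<in> space M. ?Y \<omega> \<le> a} = ennreal (g a)" for a
  proof -
    have "prob {\<omega> \<in> space M. X i \<omega> \<le> a} = (if a < 0 then 0 else 1 - exp (- a))"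
      if "i \<in> I" for i
    proof (cases "a < 0")
      case True
      \<comment> \<open>The formula for the exponential distribution function covers only
        nonnegative arguments; below zero, monotonicity compares with its value 0 at the
        origin.\<close>
      have "prob {\<omega> \<in> space M. X i \<omega> \<le> a} \<le> prob {\<omega> \<in> space M. X i \<omega> \<le> 0}"
        using True rv[OF that] by (intro finite_measure_mono) auto
      also have "\<dots> = 0"
        using exponential_distributedD_le[OF X[OF that], of 0] by simp
      finally show ?thesis
        using True by (simp add: measure_le_0_iff)
    next
      case False
      then show ?thesis
        using exponential_distributedD_le[OF X[OF that], of a] by simp
    qed
    moreover have "X i -` {..a} \<inter> space M = {\<omega> \<in> space M. X i \<omega> \<le> a}" for i
      by auto
    moreover have "{\<omega> \<in> space M. ?Y \<omega> \<le> a} = (\<Inter>i\<in>I. X i -` {..a} \<inter> space M)"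
      using assms(1,2) by auto
    ultimately have "prob {\<omega> \<in> space M. ?Y \<omega> \<le> a} = g a"
      using indep_varsD_finite[OF ind assms(2,1), of "\<lambda>_. {..a}"] n
      by (simp add: g_def)
    then show ?thesis
      by (simp add: emeasure_eq_measure)
  qed
  show "(\<integral>\<^sup>+x. ennreal (?f x * indicator {..a} x) \<partial>lborel) = ennreal (g a)" for a
  proof (cases "a < 0")
    case True
    then have "(\<lambda>x. ennreal (?f x * indicator {..a} x)) = (\<lambda>_. 0)"
      by (auto simp: exponential_density_def fun_eq_iff split: split_indicator)
    then show ?thesis
      using True by (simp only: g_def) simp
  next
    case False
    have "(\<integral>\<^sup>+x. ennreal (?f x * indicator {..a} x) \<partial>lborel) =
        (\<integral>\<^sup>+x. ennreal (real (card I) * (1 - exp (- x)) ^ (card I - 1) * exp (- x)) *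
          indicator {0..a} x \<partial>lborel)"
      by (intro nn_integral_cong) (auto simp: exponential_density_def split: split_indicator)
    \<comment> \<open>The boundary term at the origin is \<open>0 ^ card I\<close>, which vanishes
      because \<open>I\<close> is nonempty.\<close>
    also have "\<dots> = ennreal ((1 - exp (- a)) ^ card I - (1 - exp (- 0)) ^ card I)"
      using False
      by (intro nn_integral_FTC_Icc) (auto intro!: derivative_eq_intros)
    finally show ?thesis
      using False n by (simp add: g_def zero_power)
  qed
qed

text \<open>For \<open>a \<le> 0\<close> the complete gamma integral diverges at the origin, but the
  cutoff \<open>z > 0\<close> keeps away from it, so the integrand is dominated by a multiple of a
  convergent gamma integrand.\<close>

lemma set_integrable_upper_incomplete_Gamma:
  fixes a z :: real
  assumes "z > 0"
  shows "set_integrable lborel {z<..} (\<lambda>t. t powr (a - 1) * exp (- t))"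
proof -
  \<comment> \<open>This exponent is positive, so the integral for \<open>Gamma b\<close> converges,
    and \<open>a - b \<le> 0\<close>, so \<open>t powr (a - b)\<close> is largest at the left end
    \<open>z\<close>.\<close>
  define b where "b = max a 1"
  let ?G = "\<lambda>t. indicator {0..} t * t powr (b - 1) / exp t"
  have "integrable lborel ?G"
  proof (rule integrableI_nonneg)
    have "b > 0"
      by (simp add: b_def)
    from Gamma_conv_nn_integral_real[OF this, symmetric]
    show "(\<integral>\<^sup>+t. ennreal (?G t) \<partial>lborel) < \<infinity>"
      by simp
  qed auto
  then have G: "integrable lborel (\<lambda>t. z powr (a - b) * ?G t)"
    by (rule integrable_mult_right)
  have bound: "t powr (a - 1) \<le> z powr (a - b) * t powr (b - 1)" if "t > z" for t
  proof -
    have "t powr (a - b) \<le> z powr (a - b)"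
      using that assms by (intro powr_mono2') (auto simp: b_def)
    then have "t powr (a - b) * t powr (b - 1) \<le> z powr (a - b) * t powr (b - 1)"
      by (intro mult_right_mono) auto
    then show ?thesis
      by (simp add: powr_add[symmetric])
  qed
  show ?thesis
    unfolding set_integrable_def
    by (rule Bochner_Integration.integrable_bound[OF G])
       (use assms bound in \<open>auto simp: exp_minus field_simps split: split_indicator\<close>)
qed

text \<open>Stating integrability and value together lets both pass through the finite binomial sum
  at once.\<close>

lemma has_bochner_integral_powr_exp:
  fixes c \<zeta> s :: real
  assumes "c > 0" "\<zeta> > 0"
  shows "has_bochner_integral lborel (\<lambda>x. indicator {0<..} x * ((1 + \<zeta> * x) powr (s - 1) * exp (- (c * x))))
    (\<zeta> powr (s - 1) * (exp (c / \<zeta>) / c powr s) * upper_incomplete_Gamma s (c / \<zeta>))"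
proof -
  let ?h = "\<lambda>t. indicator {c / \<zeta><..} t *\<^sub>R (t powr (s - 1) * exp (- t))"
  have "has_bochner_integral lborel ?h (upper_incomplete_Gamma s (c / \<zeta>))"
    using set_integrable_upper_incomplete_Gamma[of "c / \<zeta>" s] assms
    unfolding set_integrable_def upper_incomplete_Gamma_def set_lebesgue_integral_def
    by (simp add: has_bochner_integral_integrable)
  then have "has_bochner_integral lborel (\<lambda>x. ?h (c / \<zeta> + c * x))
      (upper_incomplete_Gamma s (c / \<zeta>) /\<^sub>R \<bar>c\<bar>)"
    using assms by (subst (asm) lborel_has_bochner_integral_real_affine_iff[of c _ _ "c / \<zeta>"]) auto
  \<comment> \<open>With \<open>t = c / \<zeta> + c * x\<close> one has
    \<open>1 + \<zeta> * x = (\<zeta> / c) * t\<close> and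
    \<open>exp (- (c * x)) = exp (c / \<zeta>) * exp (- t)\<close>, which dictates this constant.
    The Jacobian \<open>1 / c\<close> then raises \<open>c powr (s - 1)\<close> in the denominator
    to \<open>c powr s\<close>.\<close>
  then have "has_bochner_integral lborel
      (\<lambda>x. (exp (c / \<zeta>) * (\<zeta> / c) powr (s - 1)) * ?h (c / \<zeta> + c * x))
      ((exp (c / \<zeta>) * (\<zeta> / c) powr (s - 1)) * (upper_incomplete_Gamma s (c / \<zeta>) /\<^sub>R \<bar>c\<bar>))"
    by (rule has_bochner_integral_mult_right)
  moreover have "(exp (c / \<zeta>) * (\<zeta> / c) powr (s - 1)) * ?h (c / \<zeta> + c * x) =
      indicator {0<..} x * ((1 + \<zeta> * x) powr (s - 1) * exp (- (c * x)))" for x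
  proof (cases "x > 0")
    case True
    have "1 + \<zeta> * x = (\<zeta> / c) * (c / \<zeta> + c * x)"
      using assms by (simp add: field_simps)
    then have "(1 + \<zeta> * x) powr (s - 1) = (\<zeta> / c) powr (s - 1) * (c / \<zeta> + c * x) powr (s - 1)"
      using assms True by (simp only: powr_mult)
    moreover have "exp (- (c * x)) = exp (c / \<zeta>) * exp (- (c / \<zeta> + c * x))"
      by (simp add: exp_add[symmetric])
    ultimately show ?thesis
      using assms True by (simp add: mult_ac)
  next
    case False
    then show ?thesis
      using assms by (simp add: zero_less_mult_iff)
  qed
  moreover have "(exp (c / \<zeta>) * (\<zeta> / c) powr (s - 1)) * (upper_incomplete_Gamma s (c / \<zeta>) /\<^sub>R \<bar>c\<bar>) =
      \<zeta> powr (s - 1) * (exp (c / \<zeta>) / c powr s) * upper_incomplete_Gamma s (c / \<zeta>)"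
    using assms by (simp add: powr_divide powr_diff field_simps)
  ultimately show ?thesis
    by simp
qed

text \<open>The extra factor \<open>exp (- x)\<close> shifts each rate from \<open>k\<close> to
  \<open>k + 1\<close>; hence every rate is positive, as the integral formula above
  requires.\<close>

lemma exp_binomial_expansion:
  fixes x :: real
  shows "(1 - exp (- x)) ^ n * exp (- x) =
    (\<Sum>k = 0..n. real (n choose k) * (- 1) ^ k * exp (- ((real k + 1) * x)))"
proof -
  have "(1 - exp (- x)) ^ n = (\<Sum>k\<le>n. real (n choose k) * (- exp (- x)) ^ k * 1 ^ (n - k))"
    using binomial_ring[of "- exp (- x)" 1 n] by simp
  then have "(1 - exp (- x)) ^ n * exp (- x) =
      (\<Sum>k = 0..n. real (n choose k) * (- exp (- x)) ^ k * exp (- x))"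
    by (simp add: sum_distrib_right atMost_atLeast0)
  also have "\<dots> = (\<Sum>k = 0..n. real (n choose k) * (- 1) ^ k * exp (- ((real k + 1) * x)))"
    by (intro sum.cong)
       (auto simp: power_minus[of "exp (- x)"] exp_of_nat_mult[symmetric] exp_add[symmetric]
         algebra_simps)
  finally show ?thesis .
qed

theorem theorem3:
  fixes P :: "'a measure" and M :: nat and \<zeta> s :: real and h :: "nat \<Rightarrow> 'a \<Rightarrow> complex"
  assumes "prob_space P"
    and "M \<ge> 1"
    and "\<zeta> > 0"
    and "prob_space.indep_vars P (\<lambda>_. borel) h {1..M}"
    and "\<And>i. i \<in> {1..M} \<Longrightarrow> distributed P lborel (h i) (\<lambda>z. ennreal (complex_normal_density 0 1 z))"
  shows "integrable P (\<lambda>\<omega>. (1 + tas_snr M \<zeta> h \<omega>) powr (s - 1)) \<and>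
    mellin_transform P (\<lambda>\<omega>. 1 + tas_snr M \<zeta> h \<omega>) s =
      real M * \<zeta> powr (s - 1) *
        (\<Sum>k = 0..M - 1. real ((M - 1) choose k) * (- 1) ^ k *
          (exp ((real k + 1) / \<zeta>) / (real k + 1) powr s) *
          upper_incomplete_Gamma s ((real k + 1) / \<zeta>))"
proof -
  interpret prob_space P by fact
  define X where "X i \<omega> = (cmod (h i \<omega>))\<^sup>2" for i \<omega>
  define Y where "Y \<omega> = Max ((\<lambda>i. X i \<omega>) ` {1..M})" for \<omega>
  let ?f = "\<lambda>x. real M * (1 - exp (- x)) ^ (M - 1) * exponential_density 1 x"
  let ?g = "\<lambda>y. (1 + \<zeta> * y) powr (s - 1)"
  let ?C = "\<lambda>k. real ((M - 1) choose k) * (- 1) ^ k"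
  let ?T = "\<lambda>k x. indicator {0<..} x * ((1 + \<zeta> * x) powr (s - 1) * exp (- ((real k + 1) * x)))"
  let ?I = "\<lambda>k. \<zeta> powr (s - 1) * (exp ((real k + 1) / \<zeta>) / (real k + 1) powr s) *
    upper_incomplete_Gamma s ((real k + 1) / \<zeta>)"
  have "indep_vars (\<lambda>_. borel) X {1..M}"
    unfolding X_def by (rule indep_vars_compose2[OF assms(4)]) auto
  moreover have "distributed P lborel (X i) (exponential_density 1)" if "i \<in> {1..M}" for i
    unfolding X_def by (rule distributed_cmod_square_complex_normal[OF assms(5)[OF that]])
  ultimately have Y: "distributed P lborel Y ?f"
    using distributed_Max_exponential[of "{1..M}" X] assms(2) unfolding Y_def by simp
  have f_nonneg: "0 \<le> ?f x" for x
    by (simp add: exponential_density_def)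
  have "has_bochner_integral lborel (\<lambda>x. real M * (\<Sum>k = 0..M - 1. ?C k * ?T k x))
      (real M * (\<Sum>k = 0..M - 1. ?C k * ?I k))"
    using assms(3)
    by (intro has_bochner_integral_mult_right has_bochner_integral_sum has_bochner_integral_powr_exp)
       auto
  \<comment> \<open>Equality can fail at the origin: \<open>?T\<close> vanishes there, while
    \<open>exponential_density 1 0 = 1\<close>, so for \<open>M = 1\<close> the right side is
    1.\<close>
  moreover have "AE x in lborel. real M * (\<Sum>k = 0..M - 1. ?C k * ?T k x) = ?f x * ?g x"
    using AE_lborel_singleton[of 0]
  proof eventually_elim
    case (elim x)
    have "(\<Sum>k = 0..M - 1. ?C k * ?T k x) = indicator {0<..} x * ?g x *
        (\<Sum>k = 0..M - 1. ?C k * exp (- ((real k + 1) * x)))"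
      by (simp add: sum_distrib_left mult_ac)
    also have "\<dots> = indicator {0<..} x * ?g x * ((1 - exp (- x)) ^ (M - 1) * exp (- x))"
      by (simp only: exp_binomial_expansion)
    finally show ?case
      using elim by (simp add: exponential_density_def split: split_indicator)
  qed
  ultimately have "has_bochner_integral lborel (\<lambda>x. ?f x * ?g x)
      (real M * (\<Sum>k = 0..M - 1. ?C k * ?I k))"
    by (subst (asm) has_bochner_integral_cong_AE) auto
  then have int: "integrable lborel (\<lambda>x. ?f x * ?g x)"
    and val: "(\<integral>x. ?f x * ?g x \<partial>lborel) = real M * (\<Sum>k = 0..M - 1. ?C k * ?I k)"
    by (auto simp: has_bochner_integral_iff)
  have snr: "1 + tas_snr M \<zeta> h \<omega> = 1 + \<zeta> * Y \<omega>" for \<omega>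
    by (simp add: tas_snr_def Y_def X_def)
  \<comment> \<open>Integrability is transferred separately because the Bochner integral of a
    non-integrable function defaults to 0, so the value alone would not show that the expectation
    exists.\<close>
  have "integrable P (\<lambda>\<omega>. ?g (Y \<omega>))"
    using distributed_integrable[OF Y, of ?g] int f_nonneg by simp
  moreover have "(\<integral>\<omega>. ?g (Y \<omega>) \<partial>P) = real M * (\<Sum>k = 0..M - 1. ?C k * ?I k)"
    using distributed_integral[OF Y, of ?g] val f_nonneg by simp
  ultimately show ?thesis
    by (simp add: snr mellin_transform_def sum_distrib_left mult_ac)
qed

end
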